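(* Let $\mathcal{H}$ be a real Hilbert space, $P\in\mathcal{P}(\mathcal{H})$ and $\beta\in[0,4)$. Assume that $A:\mathcal{H}\to 2^{\mathcal{H}}$ is maximally monotone, that $C:\mathcal{H}\to\mathcal{H}$ is $\frac{1}{\beta}$-cocoercive w.r.t. $\|\cdot\|_P$, that $\mathrm{zer}(A+C):=\{x\in\mathcal{H}:0\in Ax+Cx\}$ is nonempty, and that $M:\mathcal{H}\to\mathcal{H}$ is (single-valued and) maximally monotone, $1$-strongly monotone w.r.t. $\|\cdot\|_P$, and $L_M$-Lipschitz continuous w.r.t. $\|\cdot\|$. Let $T_{\rm FB}:=(M+A)^{-1}\circ(M-C)$ and, for $x\in\mathcal{H}$, define $$\psi_x(z):=\langle Mx-MT_{\rm FB}x,\;z-T_{\rm FB}x\rangle-\tfrac{\beta}{4}\|x-T_{\rm FB}x\|_P^2,\qquad z\in\mathcal{H}.$$ Then: (i) $\psi_x(x)\ge(1-\tfrac{\beta}{4})\|x-T_{\rm FB}x\|_P^2\ge 0$ for all $x\in\mathcal{H}$; (ii) $\psi_x(x)=0$ if and only if $x\in\mathrm{zer}(A+C)=\mathrm{fix}\,T_{\rm FB}$; (iii) $\psi_x(z)\le 0$ for all $z\in\mathrm{zer}(A+C)=\mathrm{fix}\,T_{\rm FB}$ and all $x\in\mathcal{H}$.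
   Context: $\mathcal{P}(\mathcal{H})$ is the set of bounded linear self-adjoint positive definite operators on $\mathcal{H}$ (positive definite in the sense that there are $0<\lambda_{\min}(P)\le\lambda_{\max}(P)<\infty$ with $\lambda_{\min}(P)\|x\|^2\le\langle x,Px\rangle\le\lambda_{\max}(P)\|x\|^2$ for all $x$); $\|x\|_P=\sqrt{\langle x,Px\rangle}$. $C$ is $\frac1\beta$-cocoercive w.r.t. $\|\cdot\|_P$ if $\langle Cx-Cy,x-y\rangle\ge\frac1\beta\|Cx-Cy\|_{P^{-1}}^2$ for all $x,y$; for $\beta=0$ this means that $C$ is constant. $M$ is $1$-strongly monotone w.r.t. $\|\cdot\|_P$ if $\langle Mx-My,x-y\rangle\ge\|x-y\|_P^2$ for all $x,y$. $\mathrm{fix}\,T=\{x:Tx=x\}$. Under the stated assumptions $T_{\rm FB}$ is single-valued with full domain, so $T_{\rm FB}x$ is regarded as a point of $\mathcal{H}$. *)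

theory Defs
  imports "HOL-Analysis.Analysis" "HOL-Library.Set_Algebras"
begin

text \<open>
  A set-valued operator on \<open>'a\<close> is a function \<open>'a \<Rightarrow> 'a set\<close>; a single-valued operator \<open>F\<close> is
  seen as \<open>\<lambda>x. {F x}\<close>. Values are added with the Minkowski sum of \<open>Set_Algebras\<close>.
\<close>

definition op_graph :: "('a \<Rightarrow> 'a set) \<Rightarrow> ('a \<times> 'a) set" where
  "op_graph A = {(x, u). u \<in> A x}"

definition monotone_op :: "('a::real_inner \<Rightarrow> 'a set) \<Rightarrow> bool" where
  "monotone_op A \<longleftrightarrow>
     (\<forall>(x, u) \<in> op_graph A. \<forall>(y, v) \<in> op_graph A. (u - v) \<bullet> (x - y) \<ge> 0)"

definition maximally_monotone :: "('a::real_inner \<Rightarrow> 'a set) \<Rightarrow> bool" where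
  "maximally_monotone A \<longleftrightarrow>
     monotone_op A \<and> (\<forall>B. monotone_op B \<and> op_graph A \<subseteq> op_graph B \<longrightarrow> op_graph B = op_graph A)"

definition op_sum :: "('a::plus \<Rightarrow> 'a set) \<Rightarrow> ('a \<Rightarrow> 'a set) \<Rightarrow> 'a \<Rightarrow> 'a set" where
  "op_sum A B = (\<lambda>x. A x + B x)"

definition op_inverse :: "('a \<Rightarrow> 'a set) \<Rightarrow> 'a \<Rightarrow> 'a set" where
  "op_inverse A = (\<lambda>u. {x. u \<in> A x})"

definition zer :: "('a::zero \<Rightarrow> 'a set) \<Rightarrow> 'a set" where
  "zer A = {x. 0 \<in> A x}"

definition fixset :: "('a \<Rightarrow> 'a) \<Rightarrow> 'a set" where
  "fixset T = {x. T x = x}"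

definition pos_def_op :: "('a::real_inner \<Rightarrow> 'a) \<Rightarrow> bool" where
  "pos_def_op P \<longleftrightarrow>
     bounded_linear P \<and> (\<forall>x y. P x \<bullet> y = x \<bullet> P y) \<and>
     (\<exists>lmin lmax. 0 < lmin \<and> lmin \<le> lmax \<and>
        (\<forall>x. lmin * (norm x)\<^sup>2 \<le> x \<bullet> P x \<and> x \<bullet> P x \<le> lmax * (norm x)\<^sup>2))"

definition op_norm :: "('a::real_inner \<Rightarrow> 'a) \<Rightarrow> 'a \<Rightarrow> real" where
  "op_norm P x = sqrt (x \<bullet> P x)"

text \<open>
  \<open>cocoercive_inv P \<beta> C\<close> means that \<open>C\<close> is \<open>1/\<beta>\<close>-cocoercive with respect to \<open>op_norm P\<close>.
  The case \<open>\<beta> = 0\<close> is separate because \<open>1 / 0 = 0\<close> in HOL.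
\<close>

definition cocoercive_inv :: "('a::real_inner \<Rightarrow> 'a) \<Rightarrow> real \<Rightarrow> ('a \<Rightarrow> 'a) \<Rightarrow> bool" where
  "cocoercive_inv P \<beta> C \<longleftrightarrow>
     (if \<beta> = 0 then \<exists>c. \<forall>x. C x = c
      else \<forall>x y. (C x - C y) \<bullet> (x - y) \<ge> 1 / \<beta> * (op_norm (inv P) (C x - C y))\<^sup>2)"

definition one_strongly_monotone :: "('a::real_inner \<Rightarrow> 'a) \<Rightarrow> ('a \<Rightarrow> 'a) \<Rightarrow> bool" where
  "one_strongly_monotone P M \<longleftrightarrow>
     (\<forall>x y. (M x - M y) \<bullet> (x - y) \<ge> (op_norm P (x - y))\<^sup>2)"

definition FB_op :: "('a::ab_group_add \<Rightarrow> 'a) \<Rightarrow> ('a \<Rightarrow> 'a set) \<Rightarrow> ('a \<Rightarrow> 'a) \<Rightarrow> 'a \<Rightarrow> 'a set" where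
  "FB_op M A C = op_inverse (op_sum (\<lambda>x. {M x}) A) \<circ> (\<lambda>x. M x - C x)"

text \<open>
  \<open>FB M A C x\<close> is the unique element of \<open>FB_op M A C x\<close>; it is unspecified
  if \<open>FB_op M A C x\<close> is not a singleton.
\<close>

definition FB :: "('a::ab_group_add \<Rightarrow> 'a) \<Rightarrow> ('a \<Rightarrow> 'a set) \<Rightarrow> ('a \<Rightarrow> 'a) \<Rightarrow> 'a \<Rightarrow> 'a" where
  "FB M A C x = the_elem (FB_op M A C x)"

definition FB_psi ::
  "('a::real_inner \<Rightarrow> 'a) \<Rightarrow> real \<Rightarrow> ('a \<Rightarrow> 'a) \<Rightarrow> ('a \<Rightarrow> 'a set) \<Rightarrow> ('a \<Rightarrow> 'a) \<Rightarrow> 'a \<Rightarrow> 'a \<Rightarrow> real" where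
  "FB_psi P \<beta> M A C x z =
     (M x - M (FB M A C x)) \<bullet> (z - FB M A C x) - \<beta> / 4 * (op_norm P (x - FB M A C x))\<^sup>2"

end

theory Submission
  imports Defs
begin

text \<open>
  Single-valuedness of \<open>(M + A)\<^sup>-\<^sup>1\<close> is strong monotonicity of \<open>M\<close>; its full domain is the
  surjectivity of \<open>M + A\<close>. That follows from Minty's theorem by applying the Banach fixed
  point theorem to \<open>x \<mapsto> (I + cA)\<^sup>-\<^sup>1 (x - c (M x - u))\<close> for small \<open>c > 0\<close>. Minty's theorem
  itself comes from minimising \<open>F p + (norm p)\<^sup>2 / 2\<close> for the Fitzpatrick function \<open>F\<close> of \<open>A\<close>.
  Once \<open>T x = FB M A C x\<close> is available, (iii) is monotonicity of \<open>A\<close> between \<open>T x\<close> and a zero \<open>z\<close>, with the term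
  involving \<open>C x - C z\<close> absorbed by cocoercivity and Young's inequality in the norms of
  \<open>P\<close> and \<open>inv P\<close>.
\<close>

section \<open>Minty's theorem\<close>

lemma monotone_opD:
  "monotone_op A \<Longrightarrow> u \<in> A x \<Longrightarrow> v \<in> A y \<Longrightarrow> 0 \<le> (u - v) \<bullet> (x - y)"
  unfolding monotone_op_def op_graph_def by blast

text \<open>Adjoining one pair that is monotonically related to the graph keeps the operator
  monotone, so maximality forces that pair to be in the graph already. This replaces the quantifier
  over operators by a pointwise membership test.\<close>

lemma maximally_monotone_iff:
  "maximally_monotone A \<longleftrightarrow>
     monotone_op A \<and> (\<forall>x u. (\<forall>y. \<forall>v\<in>A y. 0 \<le> (u - v) \<bullet> (x - y)) \<longrightarrow> u \<in> A x)"
proof (intro iffI conjI allI impI)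
  assume max: "maximally_monotone A"
  then show mon: "monotone_op A"
    by (simp add: maximally_monotone_def)
  fix x u
  assume rel: "\<forall>y. \<forall>v\<in>A y. 0 \<le> (u - v) \<bullet> (x - y)"
  define B where "B = A(x := insert u (A x))"
  have "0 \<le> (b - b') \<bullet> (a - a')" if "b \<in> B a" "b' \<in> B a'" for a a' b b'
  proof -
    have "(b \<in> A a \<or> (a = x \<and> b = u)) \<and> (b' \<in> A a' \<or> (a' = x \<and> b' = u))"
      using that by (auto simp: B_def split: if_splits)
    moreover have "(b - b') \<bullet> (a - a') = (b' - b) \<bullet> (a' - a)"
      by (metis inner_minus_left inner_minus_right minus_diff_eq minus_minus)
    ultimately show ?thesis
      using monotone_opD[OF mon, of b a b' a'] rel by (metis diff_self inner_zero_right order_refl)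
  qed
  then have "monotone_op B"
    by (auto simp: monotone_op_def op_graph_def)
  moreover have "op_graph A \<subseteq> op_graph B"
    by (auto simp: B_def op_graph_def)
  ultimately have "op_graph B = op_graph A"
    using max by (auto simp: maximally_monotone_def)
  moreover have "(x, u) \<in> op_graph B"
    by (simp add: B_def op_graph_def)
  ultimately show "u \<in> A x"
    by (simp add: op_graph_def)
next
  assume *: "monotone_op A \<and> (\<forall>x u. (\<forall>y. \<forall>v\<in>A y. 0 \<le> (u - v) \<bullet> (x - y)) \<longrightarrow> u \<in> A x)"
  show "maximally_monotone A"
    unfolding maximally_monotone_def
  proof (intro conjI allI impI)
    fix B assume B: "monotone_op B \<and> op_graph A \<subseteq> op_graph B"
    have "u \<in> A x" if "u \<in> B x" for x u
    proof -
      have "0 \<le> (u - v) \<bullet> (x - y)" if "v \<in> A y" for y v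
        using B that \<open>u \<in> B x\<close> by (intro monotone_opD[of B]) (auto simp: op_graph_def)
      then show ?thesis using * by blast
    qed
    then show "op_graph B = op_graph A"
      using B by (auto simp: op_graph_def)
  qed (use * in blast)
qed

lemma maximally_monotoneD:
  assumes "maximally_monotone A" and "\<And>y v. v \<in> A y \<Longrightarrow> 0 \<le> (u - v) \<bullet> (x - y)"
  shows "u \<in> A x"
  using assms unfolding maximally_monotone_iff by blast

text \<open>\<open>K\<close> stands for the epigraph of a closed convex function. Strong convexity
  of the quadratic term makes the first components of a minimising sequence Cauchy, so completeness
  supplies the minimiser.\<close>

lemma convex_min_quadratic:
  fixes K :: "('a::{real_inner, complete_space} \<times> real) set"
  assumes "convex K" "closed K" "K \<noteq> {}"
    and bound: "\<And>p t. (p, t) \<in> K \<Longrightarrow> m \<le> t + (norm p)\<^sup>2 / 2"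
  obtains p t where "(p, t) \<in> K" "\<And>q s. (q, s) \<in> K \<Longrightarrow> t + (norm p)\<^sup>2 / 2 \<le> s + (norm q)\<^sup>2 / 2"
proof -
  define g where "g = (\<lambda>z::'a \<times> real. snd z + (norm (fst z))\<^sup>2 / 2)"
  define \<mu> where "\<mu> = Inf (g ` K)"
  have bdd: "bdd_below (g ` K)"
    using bound by (auto simp: g_def intro!: bdd_belowI[of _ m])
  have \<mu>_le: "\<mu> \<le> g z" if "z \<in> K" for z
    unfolding \<mu>_def using that bdd by (intro cINF_lower)
  have "\<exists>z\<in>K. g z < \<mu> + inverse (real (Suc n))" for n
  proof -
    have "\<mu> < \<mu> + inverse (real (Suc n))" by simp
    then show ?thesis
      unfolding \<mu>_def using \<open>K \<noteq> {}\<close> bdd by (subst (asm) cInf_less_iff) auto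
  qed
  then obtain z where zK: "\<And>n. z n \<in> K" and z: "\<And>n. g (z n) < \<mu> + inverse (real (Suc n))"
    by metis
  \<comment> \<open>The midpoint of \<open>a\<close> and \<open>b\<close> lies in \<open>K\<close>,
    so its value is at least \<open>\<mu>\<close>; the parallelogram law then bounds the distance by
    the excess of both values over \<open>\<mu>\<close>.\<close>
  have gap: "(norm (fst a - fst b))\<^sup>2 \<le> 4 * (g a + g b - 2 * \<mu>)" if "a \<in> K" "b \<in> K" for a b
  proof -
    have "(1/2) *\<^sub>R a + (1/2) *\<^sub>R b \<in> K"
      using \<open>convex K\<close> that by (intro convexD) auto
    then have "\<mu> \<le> g ((1/2) *\<^sub>R a + (1/2) *\<^sub>R b)" by (rule \<mu>_le)
    also have "\<dots> = (g a + g b) / 2 - (norm (fst a - fst b))\<^sup>2 / 8"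
      unfolding g_def power2_norm_eq_inner
      by (simp add: inner_simps inner_commute[of "fst b" "fst a"] field_simps)
    finally show ?thesis by (simp add: field_simps)
  qed
  have inv0: "(\<lambda>n. inverse (real (Suc n))) \<longlonglongrightarrow> 0"
    by (rule LIMSEQ_inverse_real_of_nat)
  have "Cauchy (\<lambda>n. fst (z n))"
  proof (rule CauchyI)
    fix e :: real assume "0 < e"
    then have "\<forall>\<^sub>F n in sequentially. inverse (real (Suc n)) < e\<^sup>2 / 8"
      using order_tendstoD(2)[OF inv0, of "e\<^sup>2 / 8"] by simp
    then obtain N where N: "\<And>n. N \<le> n \<Longrightarrow> inverse (real (Suc n)) < e\<^sup>2 / 8"
      by (auto simp: eventually_sequentially)
    have "norm (fst (z i) - fst (z j)) < e" if "N \<le> i" "N \<le> j" for i j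
    proof -
      have "g (z i) < \<mu> + e\<^sup>2 / 8" "g (z j) < \<mu> + e\<^sup>2 / 8"
        using z N that by (meson add_strict_left_mono less_trans)+
      then have "(norm (fst (z i) - fst (z j)))\<^sup>2 < e\<^sup>2"
        using gap[OF zK[of i] zK[of j]] by simp
      then show ?thesis using \<open>0 < e\<close> by (intro power2_less_imp_less[of _ e]) auto
    qed
    then show "\<exists>N. \<forall>i\<ge>N. \<forall>j\<ge>N. norm (fst (z i) - fst (z j)) < e" by blast
  qed
  then obtain p where p: "(\<lambda>n. fst (z n)) \<longlonglongrightarrow> p"
    using Cauchy_convergent_iff convergent_def by blast
  have "(\<lambda>n. \<mu> + inverse (real (Suc n))) \<longlonglongrightarrow> \<mu>"
    using tendsto_add[OF tendsto_const inv0, of \<mu>] by simp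
  then have "(\<lambda>n. g (z n)) \<longlonglongrightarrow> \<mu>"
    by (intro tendsto_sandwich[OF always_eventually[OF allI[OF \<mu>_le[OF zK]]]
          always_eventually[OF allI[OF less_imp_le[OF z]]] tendsto_const])
  \<comment> \<open>The heights \<open>snd (z n)\<close> converge because both
    \<open>g (z n)\<close> and the quadratic term do.\<close>
  then have "(\<lambda>n. g (z n) - (norm (fst (z n)))\<^sup>2 / 2) \<longlonglongrightarrow> \<mu> - (norm p)\<^sup>2 / 2"
    by (intro tendsto_intros p) auto
  then have "(\<lambda>n. snd (z n)) \<longlonglongrightarrow> \<mu> - (norm p)\<^sup>2 / 2"
    by (simp add: g_def)
  then have "(\<lambda>n. (fst (z n), snd (z n))) \<longlonglongrightarrow> (p, \<mu> - (norm p)\<^sup>2 / 2)"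
    by (intro tendsto_Pair p)
  then have "(p, \<mu> - (norm p)\<^sup>2 / 2) \<in> K"
    using closed_sequentially[OF \<open>closed K\<close>] zK unfolding prod.collapse by blast
  then show thesis
    using \<mu>_le by (intro that[of p "\<mu> - (norm p)\<^sup>2 / 2"]) (auto simp: g_def)
qed

text \<open>First-order optimality: compare the minimiser with points of the segment towards
  \<open>(q, s)\<close>, divide by the step length \<open>h\<close>, and let \<open>h\<close> tend
  to 0 from the right.\<close>

lemma convex_min_quadratic_variational:
  fixes K :: "('a::{real_inner, complete_space} \<times> real) set"
  assumes "convex K" "closed K" "K \<noteq> {}"
    and "\<And>p t. (p, t) \<in> K \<Longrightarrow> m \<le> t + (norm p)\<^sup>2 / 2"
  obtains p t where "(p, t) \<in> K" "\<And>q s. (q, s) \<in> K \<Longrightarrow> 0 \<le> s - t + p \<bullet> (q - p)"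
proof -
  obtain p t where pt: "(p, t) \<in> K"
    and min: "\<And>q s. (q, s) \<in> K \<Longrightarrow> t + (norm p)\<^sup>2 / 2 \<le> s + (norm q)\<^sup>2 / 2"
    using convex_min_quadratic[OF assms] by metis
  have "0 \<le> s - t + p \<bullet> (q - p)" if qs: "(q, s) \<in> K" for q s
  proof (rule tendsto_lowerbound)
    show "((\<lambda>h. s - t + p \<bullet> (q - p) + h * (norm (q - p))\<^sup>2 / 2) \<longlongrightarrow> s - t + p \<bullet> (q - p)) (at_right 0)"
      by (auto intro!: tendsto_eq_intros)
    have "0 \<le> s - t + p \<bullet> (q - p) + h * (norm (q - p))\<^sup>2 / 2" if h: "0 < h" "h < 1" for h
    proof -
      have "(1 - h) *\<^sub>R (p, t) + h *\<^sub>R (q, s) \<in> K"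
        using \<open>convex K\<close> pt qs h by (intro convexD) auto
      then have "t + (norm p)\<^sup>2 / 2 \<le>
          (1 - h) * t + h * s + (norm ((1 - h) *\<^sub>R p + h *\<^sub>R q))\<^sup>2 / 2"
        using min by simp
      also have "(1 - h) *\<^sub>R p + h *\<^sub>R q = p + h *\<^sub>R (q - p)"
        by (simp add: algebra_simps)
      also have "(norm (p + h *\<^sub>R (q - p)))\<^sup>2 =
          (norm p)\<^sup>2 + 2 * h * (p \<bullet> (q - p)) + h * h * (norm (q - p))\<^sup>2"
        unfolding power2_norm_eq_inner
        by (simp only: inner_add_left inner_add_right inner_scaleR_left inner_scaleR_right
            inner_commute[of "q - p" p]) (simp add: algebra_simps)
      also have "(1 - h) * t + h * s + (\<dots>) / 2 =
          t + (norm p)\<^sup>2 / 2 + h * (s - t + p \<bullet> (q - p) + h * (norm (q - p))\<^sup>2 / 2)"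
        by (simp add: field_simps)
      finally have "0 \<le> h * (s - t + p \<bullet> (q - p) + h * (norm (q - p))\<^sup>2 / 2)"
        by simp
      then show ?thesis using h by (simp add: zero_le_mult_iff)
    qed
    then show "\<forall>\<^sub>F h in at_right 0. 0 \<le> s - t + p \<bullet> (q - p) + h * (norm (q - p))\<^sup>2 / 2"
      unfolding eventually_at_right_field by (intro exI[of _ 1]) auto
  qed simp
  then show thesis using that pt by blast
qed

text \<open>This is a zero of \<open>I + A\<close>. The Fitzpatrick function, the supremum of
  \<open>v \<bullet> x + y \<bullet> u - y \<bullet> v\<close> over the graph pairs
  \<open>(y, v)\<close>, dominates \<open>x \<bullet> u\<close> everywhere and is at most
  \<open>x \<bullet> u\<close> on the graph. These two facts turn optimality at a minimiser
  \<open>(x, u)\<close> into membership in \<open>A\<close>.\<close>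

lemma minty_zero:
  fixes A :: "'a::{real_inner, complete_space} \<Rightarrow> 'a set"
  assumes max: "maximally_monotone A"
  obtains x where "- x \<in> A x"
proof -
  note mon = monotone_opD[of A] max[unfolded maximally_monotone_iff, THEN conjunct1]
  \<comment> \<open>the epigraph of the Fitzpatrick function of \<open>A\<close>\<close>
  define K where "K = (\<Inter>y. \<Inter>v\<in>A y. {z::('a \<times> 'a) \<times> real. (v, y) \<bullet> fst z - y \<bullet> v \<le> snd z})"
  have "{z::('a \<times> 'a) \<times> real. (v, y) \<bullet> fst z - y \<bullet> v \<le> snd z} =
      {z. ((v, y), - 1) \<bullet> z \<le> y \<bullet> v}" for v y :: 'a
    by (auto simp: inner_prod_def)
  then have halfspaces: "K = (\<Inter>y. \<Inter>v\<in>A y. {z. ((v, y), - 1) \<bullet> z \<le> y \<bullet> v})"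
    by (simp add: K_def)
  have "convex K"
    unfolding halfspaces by (intro convex_INT convex_halfspace_le)
  moreover have "closed K"
    unfolding halfspaces by (intro closed_INT ballI closed_halfspace_le)
  moreover have graph: "((a, b), a \<bullet> b) \<in> K" if "b \<in> A a" for a b
  proof -
    have "v \<bullet> a + y \<bullet> b - y \<bullet> v \<le> a \<bullet> b" if "v \<in> A y" for y v
      using mon(1)[OF mon(2) \<open>b \<in> A a\<close> that] by (simp add: inner_simps inner_commute)
    then show ?thesis by (auto simp: K_def)
  qed
  moreover have "K \<noteq> {}"
  proof -
    \<comment> \<open>With an empty graph every pair would pass the maximality test
      vacuously.\<close>
    have "\<exists>y v. v \<in> A y"
      using maximally_monotoneD[OF max] by blast
    then show ?thesis using graph by blast
  qed
  \<comment> \<open>If \<open>t\<close> were smaller than \<open>x \<bullet> u\<close>, the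
    inequalities defining \<open>K\<close> would make \<open>(x, u)\<close> monotonically related to
    the graph, hence a member of it; the inequality for that very pair then says
    \<open>x \<bullet> u \<le> t\<close>.\<close>
  moreover have inner_le: "x \<bullet> u \<le> t" if "((x, u), t) \<in> K" for x u t
  proof (rule ccontr)
    assume neg: "\<not> x \<bullet> u \<le> t"
    have le: "v \<bullet> x + y \<bullet> u - y \<bullet> v \<le> t" if "v \<in> A y" for y v
      using \<open>((x, u), t) \<in> K\<close> that by (auto simp: K_def)
    have "u \<in> A x"
    proof (rule maximally_monotoneD[OF max])
      fix y v assume "v \<in> A y"
      from le[OF this] neg show "0 \<le> (u - v) \<bullet> (x - y)"
        by (simp add: inner_simps inner_commute algebra_simps)
    qed
    from le[OF this] neg show False by (simp add: inner_commute)
  qed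
  moreover have "0 \<le> t + (norm p)\<^sup>2 / 2" if "(p, t) \<in> K" for p t
  proof -
    obtain x u where p: "p = (x, u)" by (cases p)
    have "0 \<le> (norm (x + u))\<^sup>2" by simp
    also have "\<dots> = (norm p)\<^sup>2 + 2 * (x \<bullet> u)"
      unfolding power2_norm_eq_inner p by (simp add: inner_simps inner_commute)
    finally show ?thesis using inner_le[of x u t] that p by simp
  qed
  ultimately obtain p t where pt: "(p, t) \<in> K"
    and var: "\<And>q s. (q, s) \<in> K \<Longrightarrow> 0 \<le> s - t + p \<bullet> (q - p)"
    using convex_min_quadratic_variational[of K 0] by metis
  obtain x u where p: "p = (x, u)" by (cases p)
  have xut: "x \<bullet> u \<le> t" using inner_le pt p by simp
  \<comment> \<open>Optimality is tested at the graph point \<open>((a, b), a \<bullet> b)\<close>,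
    and \<open>t\<close> is replaced by its lower bound \<open>x \<bullet> u\<close>; the terms then
    factor.\<close>
  have key: "(norm (x + u))\<^sup>2 \<le> (b + x) \<bullet> (a + u)" if "b \<in> A a" for a b
    using var[OF graph[OF that]] xut unfolding p power2_norm_eq_inner
    by (simp add: inner_simps inner_commute algebra_simps)
  \<comment> \<open>Nonnegativity of the right-hand side of \<open>key\<close> says exactly that
    \<open>(- u, - x)\<close> is monotonically related to the graph.\<close>
  have "- x \<in> A (- u)"
  proof (rule maximally_monotoneD[OF max])
    fix y v assume "v \<in> A y"
    have "(- x - v) \<bullet> (- u - y) = (v + x) \<bullet> (y + u)"
      by (simp add: inner_simps inner_commute)
    then show "0 \<le> (- x - v) \<bullet> (- u - y)"
      using key[OF \<open>v \<in> A y\<close>] by (metis order_trans zero_le_power2)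
  qed
  \<comment> \<open>At \<open>a = - u\<close>, \<open>b = - x\<close> the right-hand side of
    \<open>key\<close> vanishes.\<close>
  from key[OF this] have "x + u = 0" by simp
  then have "- u = x" by (simp add: add_eq_0_iff)
  with \<open>- x \<in> A (- u)\<close> show thesis using that by simp
qed

text \<open>Solving \<open>w = x + c *\<^sub>R a\<close> with \<open>a \<in> A x\<close> amounts to
  finding a zero of the identity plus this rescaled and shifted operator.\<close>

lemma maximally_monotone_scaleR_translate:
  fixes A :: "'a::real_inner \<Rightarrow> 'a set"
  assumes max: "maximally_monotone A" and "0 < c"
  shows "maximally_monotone (\<lambda>x. (\<lambda>a. c *\<^sub>R a - w) ` A x)"
  unfolding maximally_monotone_iff
proof (intro conjI allI impI)
  have *: "(c *\<^sub>R a - w - (c *\<^sub>R b - w)) \<bullet> d = c * ((a - b) \<bullet> d)" for a b d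
    by (simp add: inner_simps algebra_simps)
  show "monotone_op (\<lambda>x. (\<lambda>a. c *\<^sub>R a - w) ` A x)"
  proof -
    have "0 \<le> (c *\<^sub>R a - w - (c *\<^sub>R b - w)) \<bullet> (x - y)" if "a \<in> A x" "b \<in> A y" for a b x y
      unfolding * using monotone_opD[of A, OF _ that] max \<open>0 < c\<close>
      by (simp add: maximally_monotone_def)
    then show ?thesis unfolding monotone_op_def op_graph_def by fast
  qed
  fix x u
  assume rel: "\<forall>y. \<forall>v\<in>(\<lambda>a. c *\<^sub>R a - w) ` A y. 0 \<le> (u - v) \<bullet> (x - y)"
  define u' where "u' = (1 / c) *\<^sub>R (u + w)"
  have u: "u = c *\<^sub>R u' - w" using \<open>0 < c\<close> by (simp add: u'_def)
  have "u' \<in> A x"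
  proof (rule maximally_monotoneD[OF max])
    fix y v assume "v \<in> A y"
    then have "0 \<le> (u - (c *\<^sub>R v - w)) \<bullet> (x - y)" using rel by blast
    then show "0 \<le> (u' - v) \<bullet> (x - y)"
      using \<open>0 < c\<close> unfolding u * by (simp add: zero_le_mult_iff)
  qed
  then show "u \<in> (\<lambda>a. c *\<^sub>R a - w) ` A x" using u by blast
qed

theorem minty:
  fixes A :: "'a::{real_inner, complete_space} \<Rightarrow> 'a set"
  assumes "maximally_monotone A" "0 < c"
  shows "\<exists>x. \<exists>a\<in>A x. w = x + c *\<^sub>R a"
proof -
  obtain x where "- x \<in> (\<lambda>a. c *\<^sub>R a - w) ` A x"
    using minty_zero[OF maximally_monotone_scaleR_translate[OF assms]] by blast
  then obtain a where "a \<in> A x" "- x = c *\<^sub>R a - w" by blast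
  then show ?thesis by (intro exI[of _ x] bexI[of _ a]) (auto simp: algebra_simps)
qed

section \<open>Sums with a strongly monotone Lipschitz operator\<close>

text \<open>Expanding the square bounds the squared Lipschitz factor of the forward step by
  \<open>1 - 2 * c * m + c\<^sup>2 * L\<^sup>2\<close>, which is below 1 for small
  \<open>c\<close>.\<close>

lemma strongly_monotone_step_contraction:
  fixes M :: "'a::real_inner \<Rightarrow> 'a"
  assumes "0 < m" and strong: "\<And>x y. m * (norm (x - y))\<^sup>2 \<le> (M x - M y) \<bullet> (x - y)"
    and lip: "L-lipschitz_on UNIV M"
  obtains c q where "0 < c" "0 \<le> q" "q < 1"
    "\<And>x y. norm ((x - c *\<^sub>R M x) - (y - c *\<^sub>R M y)) \<le> q * norm (x - y)"
proof -
  \<comment> \<open>A damped version of the minimiser \<open>m / L\<^sup>2\<close> of that quadratic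
    in \<open>c\<close>: the extra \<open>m\<^sup>2\<close> keeps the denominator positive even for
    \<open>L = 0\<close> and yields \<open>r = L\<^sup>2 / (L\<^sup>2 + m\<^sup>2)\<close>.\<close>
  define c where "c = m / (L\<^sup>2 + m\<^sup>2)"
  define r where "r = 1 - m\<^sup>2 / (L\<^sup>2 + m\<^sup>2)"
  have den: "0 < L\<^sup>2 + m\<^sup>2" using \<open>0 < m\<close> by (simp add: add_nonneg_pos)
  have "0 \<le> L" using lip by (rule lipschitz_on_nonneg)
  have "0 < c" using \<open>0 < m\<close> den by (simp add: c_def)
  have r: "0 \<le> r" "r < 1" using den \<open>0 < m\<close> by (auto simp: r_def field_simps)
  have coeff: "1 - 2 * c * m + c\<^sup>2 * L\<^sup>2 \<le> r"
  proof -
    have "c\<^sup>2 * L\<^sup>2 \<le> c * (c * (L\<^sup>2 + m\<^sup>2))"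
      using \<open>0 < c\<close> by (simp add: power2_eq_square algebra_simps)
    also have "c * (L\<^sup>2 + m\<^sup>2) = m" using den by (simp add: c_def)
    finally have "c\<^sup>2 * L\<^sup>2 \<le> c * m" .
    moreover have "r = 1 - c * m" by (simp add: r_def c_def power2_eq_square)
    ultimately show ?thesis by simp
  qed
  have "norm ((x - c *\<^sub>R M x) - (y - c *\<^sub>R M y)) \<le> sqrt r * norm (x - y)" for x y
  proof -
    have "norm (M x - M y) \<le> L * norm (x - y)"
      using lipschitz_onD[OF lip, of x y] by (simp add: dist_norm)
    then have "(norm (M x - M y))\<^sup>2 \<le> L\<^sup>2 * (norm (x - y))\<^sup>2"
      using power_mono[of "norm (M x - M y)" "L * norm (x - y)" 2] by (simp add: power_mult_distrib)
    then have 1: "c\<^sup>2 * (norm (M x - M y))\<^sup>2 \<le> c\<^sup>2 * (L\<^sup>2 * (norm (x - y))\<^sup>2)"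
      by (rule mult_left_mono) simp
    have 2: "c * (m * (norm (x - y))\<^sup>2) \<le> c * ((M x - M y) \<bullet> (x - y))"
      using strong \<open>0 < c\<close> by (intro mult_left_mono) auto
    have "(x - c *\<^sub>R M x) - (y - c *\<^sub>R M y) = (x - y) - c *\<^sub>R (M x - M y)"
      by (simp add: algebra_simps)
    then have "(norm ((x - c *\<^sub>R M x) - (y - c *\<^sub>R M y)))\<^sup>2 =
        (norm (x - y))\<^sup>2 - 2 * (c * ((M x - M y) \<bullet> (x - y))) + c\<^sup>2 * (norm (M x - M y))\<^sup>2"
      unfolding power2_norm_eq_inner
      by (simp only: inner_diff_left[of "x - y"] inner_diff_right[of _ "x - y"] inner_scaleR_left
          inner_scaleR_right inner_commute[of "x - y" "M x - M y"])
         (simp add: power2_eq_square algebra_simps)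
    also have "\<dots> \<le> (1 - 2 * c * m + c\<^sup>2 * L\<^sup>2) * (norm (x - y))\<^sup>2"
      using 1 2 by (simp add: algebra_simps)
    also have "\<dots> \<le> r * (norm (x - y))\<^sup>2"
      using coeff by (intro mult_right_mono) auto
    also have "\<dots> = (sqrt r * norm (x - y))\<^sup>2"
      using r by (simp add: power_mult_distrib)
    finally show ?thesis
      by (rule power2_le_imp_le) (use r in simp)
  qed
  then show thesis
    using \<open>0 < c\<close> r by (intro that[of c "sqrt r"]) auto
qed

theorem strongly_monotone_plus_maximal_surj:
  fixes M :: "'a::{real_inner, complete_space} \<Rightarrow> 'a"
  assumes max: "maximally_monotone A"
    and "0 < m" "\<And>x y. m * (norm (x - y))\<^sup>2 \<le> (M x - M y) \<bullet> (x - y)" "L-lipschitz_on UNIV M"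
  shows "\<exists>x. \<exists>a\<in>A x. u = M x + a"
proof -
  obtain c q where c: "0 < c" and q: "0 \<le> q" "q < 1"
    and contr: "\<And>x y. norm ((x - c *\<^sub>R M x) - (y - c *\<^sub>R M y)) \<le> q * norm (x - y)"
    using strongly_monotone_step_contraction[OF assms(2-4)] by metis
  \<comment> \<open>\<open>J\<close> is the resolvent of \<open>c A\<close>, and \<open>b\<close> is
    its Yosida approximation.\<close>
  obtain J b where b: "\<And>w. b w \<in> A (J w)" and J: "\<And>w. w = J w + c *\<^sub>R b w"
    using minty[OF max c] by metis
  \<comment> \<open>Monotonicity of \<open>A\<close> makes \<open>J\<close> firmly nonexpansive;
    Cauchy-Schwarz then gives nonexpansiveness.\<close>
  have nonexp: "norm (J w - J w') \<le> norm (w - w')" for w w'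
  proof -
    have "0 \<le> c * ((b w - b w') \<bullet> (J w - J w'))"
      using monotone_opD[of A, OF _ b b] max c by (simp add: maximally_monotone_def)
    moreover have "w - w' = (J w - J w') + c *\<^sub>R (b w - b w')"
      using J[of w] J[of w'] by (metis add_diff_add scaleR_diff_right)
    then have "(w - w') \<bullet> (J w - J w') =
        (norm (J w - J w'))\<^sup>2 + c * ((b w - b w') \<bullet> (J w - J w'))"
      unfolding power2_norm_eq_inner by (metis inner_add_left inner_scaleR_left)
    ultimately have "(norm (J w - J w'))\<^sup>2 \<le> (w - w') \<bullet> (J w - J w')" by simp
    also have "\<dots> \<le> norm (w - w') * norm (J w - J w')" by (rule norm_cauchy_schwarz)
    finally show ?thesis
      by (metis mult_right_le_imp_le norm_ge_zero norm_not_less_zero not_le order_le_less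
          power2_eq_square)
  qed
  \<comment> \<open>A fixed point of this forward-backward map solves the inclusion: cancelling
    \<open>x\<close> in the resolvent equation leaves \<open>u = M x + b w\<close>.\<close>
  define f where "f = (\<lambda>x. J (x - c *\<^sub>R M x + c *\<^sub>R u))"
  have "dist (f x) (f y) \<le> q * dist x y" for x y
    using order_trans[OF nonexp[of "x - c *\<^sub>R M x + c *\<^sub>R u" "y - c *\<^sub>R M y + c *\<^sub>R u"]] contr[of x y]
    by (simp add: f_def dist_norm)
  then obtain x where x: "f x = x"
    using banach_fix_type[OF q] by metis
  define w where "w = x - c *\<^sub>R M x + c *\<^sub>R u"
  have Jw: "J w = x" using x by (simp add: f_def w_def)
  have "c *\<^sub>R u = c *\<^sub>R (M x + b w)"
    using J[of w] unfolding Jw by (simp add: w_def algebra_simps)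
  then have "u = M x + b w" using c by simp
  then show ?thesis using b[of w] Jw by auto
qed

text \<open>With this operator as \<open>A\<close>, the surjectivity theorem speaks of a strongly
  monotone Lipschitz map alone; it is applied to \<open>P\<close> below.\<close>

lemma maximally_monotone_zero: "maximally_monotone (\<lambda>_::'a::real_inner. {0})"
  unfolding maximally_monotone_iff
proof (intro conjI allI impI)
  fix x u :: 'a
  assume "\<forall>y. \<forall>v\<in>{0}. 0 \<le> (u - v) \<bullet> (x - y)"
  \<comment> \<open>The test point is \<open>y = x + u\<close>, which turns the inequality into
    \<open>0 \<le> - (u \<bullet> u)\<close>.\<close>
  then have "0 \<le> u \<bullet> (x - (x + u))" by (metis diff_zero singletonI)
  then have "(norm u)\<^sup>2 \<le> 0" by (simp add: power2_norm_eq_inner)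
  then show "u \<in> {0}" by simp
qed (auto simp: monotone_op_def op_graph_def)

section \<open>The metric of a positive definite operator\<close>

lemma pos_def_opE:
  assumes "pos_def_op P"
  obtains l where "bounded_linear P" "\<And>x y. P x \<bullet> y = x \<bullet> P y" "0 < l"
    "\<And>x. l * (norm x)\<^sup>2 \<le> x \<bullet> P x"
  using assms unfolding pos_def_op_def by blast

lemma pos_def_op_nonneg: "pos_def_op P \<Longrightarrow> 0 \<le> x \<bullet> P x"
  by (elim pos_def_opE) (metis less_imp_le mult_nonneg_nonneg order_trans zero_le_power2)

lemma op_norm_sq: "pos_def_op P \<Longrightarrow> (op_norm P x)\<^sup>2 = x \<bullet> P x"
  by (simp add: op_norm_def pos_def_op_nonneg)

lemma op_norm_eq_0_iff:
  assumes "pos_def_op P" shows "op_norm P x = 0 \<longleftrightarrow> x = 0"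
proof
  obtain l where l: "0 < l" "l * (norm x)\<^sup>2 \<le> x \<bullet> P x"
    using pos_def_opE[OF assms] by metis
  assume "op_norm P x = 0"
  then have "x \<bullet> P x = 0" by (simp add: op_norm_def)
  with l have "l * (norm x)\<^sup>2 = 0" by (metis less_imp_le mult_nonneg_nonneg order_antisym zero_le_power2)
  with l show "x = 0" by simp
qed (simp add: op_norm_def)

text \<open>Coercivity makes the linear map \<open>P\<close> strongly monotone, and boundedness
  makes it Lipschitz, so surjectivity follows as in Lax-Milgram. This makes \<open>inv P\<close> a
  genuine two-sided inverse.\<close>

lemma pos_def_op_bij:
  fixes P :: "'a::{real_inner, complete_space} \<Rightarrow> 'a"
  assumes "pos_def_op P" shows "bij P"
proof (rule bijI)
  obtain l where lin: "bounded_linear P" and l: "0 < l" "\<And>x. l * (norm x)\<^sup>2 \<le> x \<bullet> P x"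
    using pos_def_opE[OF assms] by metis
  interpret bounded_linear P by (rule lin)
  have strong: "l * (norm (x - y))\<^sup>2 \<le> (P x - P y) \<bullet> (x - y)" for x y
    using l(2)[of "x - y"] by (simp add: diff inner_commute)
  show "inj P"
  proof (rule injI)
    fix x y assume "P x = P y"
    with strong[of x y] l(1) show "x = y" by (simp add: mult_le_0_iff)
  qed
  obtain L where "L-lipschitz_on UNIV P"
    using bounded_linear.lipschitz_boundE[OF lin] by metis
  then show "surj P"
    using strongly_monotone_plus_maximal_surj[OF maximally_monotone_zero l(1) strong]
    by (fastforce simp: surj_def)
qed

text \<open>Split \<open>z - y\<close> as \<open>(x - y) - (x - z)\<close>. Young's inequality
  bounds the first contribution at the cost of \<open>1 / \<beta>\<close> times the squared
  \<open>inv P\<close> norm of \<open>C x - C z\<close>, which cocoercivity gains back from the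
  second.\<close>

lemma cocoercive_young:
  fixes P :: "'a::{real_inner, complete_space} \<Rightarrow> 'a"
  assumes P: "pos_def_op P" and "0 \<le> \<beta>" and C: "cocoercive_inv P \<beta> C"
  shows "(C x - C z) \<bullet> (z - y) \<le> \<beta> / 4 * (op_norm P (x - y))\<^sup>2"
proof (cases "\<beta> = 0")
  case True
  then obtain k where "\<And>x. C x = k" using C by (auto simp: cocoercive_inv_def)
  then show ?thesis using True by simp
next
  case False
  then have "0 < \<beta>" using \<open>0 \<le> \<beta>\<close> by simp
  obtain l where lin: "bounded_linear P" and sym: "\<And>x y. P x \<bullet> y = x \<bullet> P y"
    using pos_def_opE[OF P] by metis
  interpret bounded_linear P by (rule lin)
  \<comment> \<open>Passing to \<open>w\<close> expresses the \<open>inv P\<close> norm as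
    \<open>w \<bullet> P w\<close>, so the computation uses only linearity and symmetry of
    \<open>P\<close>.\<close>
  define w where "w = inv P (C x - C z)"
  have Pw: "P w = C x - C z"
    unfolding w_def by (simp add: pos_def_op_bij[OF P] bij_is_surj surj_f_inv_f)
  have wPw: "(op_norm (inv P) (C x - C z))\<^sup>2 = w \<bullet> P w"
  proof -
    have "(C x - C z) \<bullet> w = w \<bullet> P w" by (simp add: Pw inner_commute)
    then show ?thesis
      unfolding op_norm_def w_def[symmetric] using pos_def_op_nonneg[OF P, of w] by simp
  qed
  have coc: "1 / \<beta> * (w \<bullet> P w) \<le> (C x - C z) \<bullet> (x - z)"
    using C False wPw unfolding cocoercive_inv_def by metis
  \<comment> \<open>Young's inequality as a nonnegative square; the weight
    \<open>\<beta> / 2\<close> produces the coefficients \<open>1 / \<beta>\<close> and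
    \<open>\<beta> / 4\<close> after division by \<open>\<beta>\<close>.\<close>
  have "0 \<le> (w - (\<beta> / 2) *\<^sub>R (x - y)) \<bullet> P (w - (\<beta> / 2) *\<^sub>R (x - y))"
    by (rule pos_def_op_nonneg[OF P])
  also have "\<dots> = w \<bullet> P w - \<beta> * (P w \<bullet> (x - y)) + \<beta> * (\<beta> / 4) * ((x - y) \<bullet> P (x - y))"
    unfolding diff[of w] scaleR sym[of w]
    by (simp only: inner_diff_left[of w] inner_diff_right[of _ "P w"] inner_scaleR_left
        inner_scaleR_right inner_commute[of "x - y" "P w"] sym[of w]) (simp add: field_simps)
  finally have "\<beta> * (P w \<bullet> (x - y)) \<le> \<beta> * (1 / \<beta> * (w \<bullet> P w) + \<beta> / 4 * ((x - y) \<bullet> P (x - y)))"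
    using \<open>0 < \<beta>\<close> by (simp add: algebra_simps)
  then have "P w \<bullet> (x - y) \<le> 1 / \<beta> * (w \<bullet> P w) + \<beta> / 4 * ((x - y) \<bullet> P (x - y))"
    using \<open>0 < \<beta>\<close> by (rule mult_left_le_imp_le)
  moreover have "(C x - C z) \<bullet> (z - y) = P w \<bullet> (x - y) - (C x - C z) \<bullet> (x - z)"
    unfolding Pw by (simp add: inner_simps)
  ultimately show ?thesis using coc by (simp add: op_norm_sq[OF P])
qed

section \<open>The forward-backward operator\<close>

lemma mem_FB_op_iff: "y \<in> FB_op M A C x \<longleftrightarrow> M x - C x - M y \<in> A y"
proof -
  have "M x - C x = M y + a \<longleftrightarrow> a = M x - C x - M y" for a
    by (auto simp: algebra_simps)
  then show ?thesis
    by (auto simp: FB_op_def op_inverse_def op_sum_def set_plus_def)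
qed

text \<open>This justifies \<open>the_elem\<close> in \<open>FB\<close>. A point exists by
  surjectivity of \<open>M + A\<close>; for two points, monotonicity of \<open>A\<close> and strong
  monotonicity of \<open>M\<close> give opposite signs.\<close>

lemma FB_op_eq_singleton:
  fixes P :: "'a::{real_inner, complete_space} \<Rightarrow> 'a"
  assumes P: "pos_def_op P" and A: "maximally_monotone A"
    and M: "one_strongly_monotone P M" and lip: "L-lipschitz_on UNIV M"
  shows "FB_op M A C x = {FB M A C x}"
proof -
  obtain l where l: "0 < l" "\<And>x. l * (norm x)\<^sup>2 \<le> x \<bullet> P x"
    using pos_def_opE[OF P] by metis
  have strong: "l * (norm (x - y))\<^sup>2 \<le> (M x - M y) \<bullet> (x - y)" for x y
    using M l(2)[of "x - y"] order_trans
    unfolding one_strongly_monotone_def op_norm_sq[OF P] by blast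
  obtain t a where "a \<in> A t" "M x - C x = M t + a"
    using strongly_monotone_plus_maximal_surj[OF A l(1) strong lip] by metis
  then have t: "t \<in> FB_op M A C x"
    by (simp add: mem_FB_op_iff)
  have "y = t" if y: "y \<in> FB_op M A C x" for y
  proof -
    have "0 \<le> (M x - C x - M y - (M x - C x - M t)) \<bullet> (y - t)"
      using A y t by (intro monotone_opD[of A]) (auto simp: maximally_monotone_def mem_FB_op_iff)
    also have "\<dots> = - ((M y - M t) \<bullet> (y - t))" by (simp add: inner_simps)
    finally have "l * (norm (y - t))\<^sup>2 \<le> 0" using strong[of y t] by linarith
    then show ?thesis using l(1) by (simp add: mult_le_0_iff)
  qed
  then have "FB_op M A C x = {t}" using t by blast
  then show ?thesis by (simp add: FB_def)
qed

theorem theorem1: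
  fixes P :: "'a::{real_inner, complete_space} \<Rightarrow> 'a"
    and \<beta> L_M :: real
    and A :: "'a \<Rightarrow> 'a set"
    and C M :: "'a \<Rightarrow> 'a"
  assumes "pos_def_op P"
    and "0 \<le> \<beta>" and "\<beta> < 4"
    and "maximally_monotone A"
    and "cocoercive_inv P \<beta> C"
    and "zer (op_sum A (\<lambda>x. {C x})) \<noteq> {}"
    and "maximally_monotone (\<lambda>x. {M x})"
    and "one_strongly_monotone P M"
    and "L_M-lipschitz_on UNIV M"
  shows "(\<forall>x. FB_psi P \<beta> M A C x x \<ge> (1 - \<beta> / 4) * (op_norm P (x - FB M A C x))\<^sup>2 \<and>
              (1 - \<beta> / 4) * (op_norm P (x - FB M A C x))\<^sup>2 \<ge> 0)
       \<and> zer (op_sum A (\<lambda>x. {C x})) = fixset (FB M A C)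
       \<and> (\<forall>x. FB_psi P \<beta> M A C x x = 0 \<longleftrightarrow> x \<in> zer (op_sum A (\<lambda>x. {C x})))
       \<and> (\<forall>z \<in> zer (op_sum A (\<lambda>x. {C x})). \<forall>x. FB_psi P \<beta> M A C x z \<le> 0)"
proof -
  let ?T = "FB M A C"
  let ?Z = "zer (op_sum A (\<lambda>x. {C x}))"
  have T: "FB_op M A C x = {?T x}" for x
    using FB_op_eq_singleton[OF assms(1,4,8,9)] .
  have zer: "x \<in> ?Z \<longleftrightarrow> - C x \<in> A x" for x
  proof -
    have "0 = a + C x \<longleftrightarrow> a = - C x" for a
      unfolding eq_neg_iff_add_eq_0 by (rule eq_commute)
    then show ?thesis
      by (auto simp: zer_def op_sum_def set_plus_def)
  qed
  \<comment> \<open>For \<open>y = x\<close> the two values of \<open>M\<close> in the inclusion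
    cancel, leaving \<open>- C x \<in> A x\<close>.\<close>
  have fixT: "x \<in> ?Z \<longleftrightarrow> ?T x = x" for x
  proof -
    have "x \<in> ?Z \<longleftrightarrow> x \<in> FB_op M A C x" by (simp add: zer mem_FB_op_iff)
    then show ?thesis unfolding T by auto
  qed
  have i: "FB_psi P \<beta> M A C x x \<ge> (1 - \<beta> / 4) * (op_norm P (x - ?T x))\<^sup>2" for x
    using assms(8) unfolding FB_psi_def one_strongly_monotone_def by (simp add: algebra_simps)
  have nonneg: "(1 - \<beta> / 4) * (op_norm P (x - ?T x))\<^sup>2 \<ge> 0" for x
    using assms(3) by simp
  have ii: "FB_psi P \<beta> M A C x x = 0 \<longleftrightarrow> x \<in> ?Z" for x
  proof
    assume "FB_psi P \<beta> M A C x x = 0"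
    then have "(1 - \<beta> / 4) * (op_norm P (x - ?T x))\<^sup>2 = 0"
      using i[of x] nonneg[of x] by linarith
    \<comment> \<open>Here \<open>\<beta> < 4\<close> enters strictly: the factor
      \<open>1 - \<beta> / 4\<close> can be cancelled.\<close>
    then have "x - ?T x = 0"
      using assms(3) op_norm_eq_0_iff[OF assms(1)] by simp
    then show "x \<in> ?Z" by (simp add: fixT)
  next
    assume "x \<in> ?Z"
    then show "FB_psi P \<beta> M A C x x = 0" by (simp add: fixT FB_psi_def op_norm_def)
  qed
  have iii: "FB_psi P \<beta> M A C x z \<le> 0" if "z \<in> ?Z" for x z
  proof -
    have "M x - C x - M (?T x) \<in> A (?T x)"
      using T[of x] mem_FB_op_iff by blast
    \<comment> \<open>Monotonicity of \<open>A\<close> between the pair at \<open>?T x\<close> and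
      the pair \<open>(z, - C z)\<close>; what remains besides the \<open>M\<close> term of
      \<open>FB_psi\<close> is the quantity bounded by \<open>cocoercive_young\<close>.\<close>
    then have "0 \<le> (M x - C x - M (?T x) - - C z) \<bullet> (?T x - z)"
      using assms(4) that by (intro monotone_opD[of A]) (auto simp: zer maximally_monotone_def)
    also have "\<dots> = (C x - C z) \<bullet> (z - ?T x) - (M x - M (?T x)) \<bullet> (z - ?T x)"
      by (simp add: inner_simps)
    finally show ?thesis
      using cocoercive_young[OF assms(1,2,5), of x z "?T x"] by (simp add: FB_psi_def)
  qed
  have "?Z = fixset ?T" by (auto simp: fixset_def fixT)
  then show ?thesis using i nonneg ii iii by blast
qed

end
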